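(* Let $d$ be the Hilbert-space dimension, $\delta\in(0,1)$ the confidence parameter, and $B=n\times S$ the total budget. Define $$\mathcal{G}(n)=\frac{2\sqrt d}{\sqrt n}+\sqrt{\frac{n\log(2n/\delta)}{2B}},\qquad \mathcal{G}_C(n)=\frac{2\sqrt d}{\sqrt n}+\sqrt{\frac{n\log(2B/\delta)}{2B}}.$$ Then under the total budget $B=n\times S$: (1) The allocation minimising the conservative surrogate $\mathcal{G}_C(n)$ is $$n^*=2\sqrt{\frac{2dB}{\log(2B/\delta)}},\qquad S^*=\frac{B}{n^*}=\frac12\sqrt{\frac{B\log(2B/\delta)}{2d}}.$$ (2) Both $n^*$ and $S^*$ scale as $\sqrt{B/\log B}$. (3) At this surrogate allocation, $$\mathcal{G}_C(n^* )=O\left(\left(\frac{d\log(2B/\delta)}{B}\right)^{1/4}\right).$$ (4) The exact minimiser of the original objective $\mathcal{G}(n)$ (with $\log(2n/\delta)$ treated as a function of $n$) satisfies the implicit equation $$n\bigl(\log(2n/\delta)+1\bigr)=2\sqrt{2dB\log(2n/\delta)},$$ which can be solved numerically; the surrogate minimiser $n^*$ has the same asymptotic scaling as this exact minimiser.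
   Context: A quantum learning experiment uses $n$ distinct training states, each a density matrix on a $d$-dimensional Hilbert space, and $S$ measurement shots per state; the total measurement budget is $B=nS$, and $n$, $S$ are treated as positive real variables, with $S=B/n$. The function $\mathcal{G}$ is the original objective, a sum of a finite-sample term and a finite-shot term, and $\mathcal{G}_C$ is its conservative surrogate, obtained by replacing $\log(2n/\delta)$ by $\log(2B/\delta)$; for $n\le B$ one has $\mathcal{G}(n)\le\mathcal{G}_C(n)$. The asymptotic scalings are in $B$. Here $\log$ is the natural logarithm.
   Formalization: In (2), S* scales as √(B log B), so its claimed √(B/log B) is false and is proved only up to log factors, with the sharp rate added; in (4), a minimiser at the endpoint n=δ/2 is excluded when B<1, where the equation fails; "can be solved numerically" is omitted. *)

theory Defs
  imports "HOL-Library.Landau_Symbols" Complex_Main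
begin

definition G :: "nat \<Rightarrow> real \<Rightarrow> real \<Rightarrow> real \<Rightarrow> real" where
  "G d \<delta> B n = 2 * sqrt (real d) / sqrt n + sqrt (n * ln (2 * n / \<delta>) / (2 * B))"

definition G_C :: "nat \<Rightarrow> real \<Rightarrow> real \<Rightarrow> real \<Rightarrow> real" where
  "G_C d \<delta> B n = 2 * sqrt (real d) / sqrt n + sqrt (n * ln (2 * B / \<delta>) / (2 * B))"

definition n_star :: "nat \<Rightarrow> real \<Rightarrow> real \<Rightarrow> real" where
  "n_star d \<delta> B = 2 * sqrt (2 * real d * B / ln (2 * B / \<delta>))"

definition S_star :: "nat \<Rightarrow> real \<Rightarrow> real \<Rightarrow> real" where
  "S_star d \<delta> B = B / n_star d \<delta> B"

text \<open>
  The candidates are the positive reals at which the square root in \<^const>\<open>G\<close> has a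
  nonnegative argument, that is, the half-line from \<open>\<delta> / 2\<close> on. The restriction is needed
  because \<^const>\<open>sqrt\<close> is total and takes negative values at negative arguments.
\<close>

definition exact_minimiser :: "nat \<Rightarrow> real \<Rightarrow> real \<Rightarrow> real \<Rightarrow> bool" where
  "exact_minimiser d \<delta> B n \<longleftrightarrow>
     is_arg_min (G d \<delta> B) (\<lambda>m. 0 < m \<and> 0 \<le> ln (2 * m / \<delta>)) n"

text \<open>
  Equality of growth at infinity up to polylogarithmic factors (Theta with a tilde). The scaling
  \<open>sqrt (B / ln B)\<close> of \<^const>\<open>S_star\<close> can only be meant in this sense: its closed form grows
  exactly like \<open>sqrt (B * ln B)\<close>.
\<close>

definition soft_bigtheta :: "(real \<Rightarrow> real) \<Rightarrow> (real \<Rightarrow> real) set" where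
  "soft_bigtheta g =
     {f. \<exists>k::nat. f \<in> O(\<lambda>x. g x * ln x ^ k) \<and> g \<in> O(\<lambda>x. f x * ln x ^ k)}"

end

theory Submission
  imports Defs "HOL-Real_Asymp.Real_Asymp"
begin

text \<open>
  Completing the square in \<open>sqrt n\<close> shows that \<^const>\<open>G_C\<close> is minimal exactly at \<open>n\<^sup>*\<close>, where both
  of its terms equal \<open>2 sqrt d / sqrt n\<^sup>*\<close>.

  For the exact objective put \<open>n = (\<delta> / 2) exp (t\<^sup>2)\<close>, so that \<open>t\<^sup>2 = ln (2 n / \<delta>)\<close>. This removes the
  singularity of the derivative at \<open>n = \<delta> / 2\<close>: the objective becomes
  \<open>A exp (-t\<^sup>2 / 2) + D t exp (t\<^sup>2 / 2)\<close> on \<open>t \<ge> 0\<close>, and its derivative has the sign of the strictly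
  convex function \<open>D exp (t\<^sup>2) (1 + t\<^sup>2) - A t\<close>. Between two zeros of the latter the objective
  decreases strictly, so at most one interior point is a global minimiser; for \<open>B \<ge> 1\<close> the boundary
  point \<open>t = 0\<close> is beaten by \<open>t = 1 / 2\<close>.

  An exact minimiser \<open>n\<close> satisfies \<open>2 sqrt d / sqrt n \<le> G n \<le> G n\<^sup>* \<le> G_C n\<^sup>* = 4 sqrt d / sqrt n\<^sup>*\<close>,
  hence \<open>n \<ge> n\<^sup>* / 4\<close>. Thus \<open>ln (2 n / \<delta>)\<close> is at least a quarter of \<open>ln (2 B / \<delta>)\<close> for large \<open>B\<close>, and the
  implicit equation yields \<open>n \<le> 2 n\<^sup>*\<close>.
\<close>

section \<open>Closed forms for the conservative surrogate\<close>

lemma n_star_pos: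
  assumes "d \<ge> 1" "0 < \<delta>" "\<delta> < 2 * B"
  shows "n_star d \<delta> B > 0"
  using assms by (simp add: n_star_def)

text \<open>In \<open>x = sqrt n\<close> the surrogate is \<open>a / x + b * x\<close> with constant
  coefficients. The remainder term is nonnegative and vanishes only at \<open>n_star\<close>, so
  minimal value and uniqueness can both be read off.\<close>

lemma G_C_eq_completed_square:
  assumes d: "d \<ge> 1" and \<delta>: "0 < \<delta>" and B: "\<delta> < 2 * B" and n: "0 < n"
  shows "G_C d \<delta> B n = 4 * sqrt (real d) / sqrt (n_star d \<delta> B) +
           sqrt (ln (2 * B / \<delta>) / (2 * B)) * (sqrt n - sqrt (n_star d \<delta> B))\<^sup>2 / sqrt n"
proof -
  define L where "L = ln (2 * B / \<delta>)"
  define b where "b = sqrt (L / (2 * B))"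
  define x where "x = sqrt n"
  define y where "y = sqrt (n_star d \<delta> B)"
  have L: "L > 0" and B0: "B > 0" using \<delta> B by (auto simp: L_def)
  have x: "x > 0" using n by (simp add: x_def)
  have y: "y > 0" using n_star_pos[OF d \<delta> B] by (simp add: y_def)
  have y2: "y\<^sup>2 = 2 * sqrt (2 * real d * B / L)"
    using n_star_pos[OF d \<delta> B] by (simp add: y_def n_star_def L_def)
  have "b * sqrt (2 * real d * B / L) = sqrt (real d)"
    unfolding b_def real_sqrt_mult[symmetric] using L B0 by simp
  \<comment> \<open>Balance of the two terms at the optimum: \<open>n_star\<close> is the ratio of
    the coefficients of \<open>1 / x\<close> and \<open>x\<close>.\<close>
  hence a: "2 * sqrt (real d) = b * y\<^sup>2" by (simp add: y2)
  have "G_C d \<delta> B n = 2 * sqrt (real d) / x + b * x"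
    by (simp add: G_C_def x_def b_def L_def real_sqrt_mult real_sqrt_divide)
  also have "\<dots> = b * y\<^sup>2 / x + b * x" by (simp add: a)
  also have "\<dots> = 2 * (b * y\<^sup>2) / y + b * (x - y)\<^sup>2 / x"
    using x y by (simp add: field_simps power2_eq_square)
  also have "2 * (b * y\<^sup>2) = 4 * sqrt (real d)" by (simp add: a[symmetric])
  finally show ?thesis by (simp add: b_def x_def y_def L_def)
qed

lemma G_C_n_star:
  assumes "d \<ge> 1" "0 < \<delta>" "\<delta> < 2 * B"
  shows "G_C d \<delta> B (n_star d \<delta> B) = 4 * sqrt (real d) / sqrt (n_star d \<delta> B)"
  using G_C_eq_completed_square[OF assms n_star_pos[OF assms]] by simp

lemma is_arg_min_G_C_iff:
  assumes d: "d \<ge> 1" and \<delta>: "0 < \<delta>" and B: "\<delta> < 2 * B"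
  shows "is_arg_min (G_C d \<delta> B) (\<lambda>m. 0 < m) n \<longleftrightarrow> n = n_star d \<delta> B"
proof -
  have L: "ln (2 * B / \<delta>) / (2 * B) > 0" using \<delta> B by simp
  have less: "G_C d \<delta> B (n_star d \<delta> B) < G_C d \<delta> B m" if "m > 0" "m \<noteq> n_star d \<delta> B" for m
    using that L n_star_pos[OF d \<delta> B]
    by (simp add: G_C_n_star[OF d \<delta> B] G_C_eq_completed_square[OF d \<delta> B])
  show ?thesis
    using less n_star_pos[OF d \<delta> B] unfolding is_arg_min_def by (metis less_asym)
qed

lemma S_star_eq:
  assumes d: "d \<ge> 1" and \<delta>: "0 < \<delta>" and B: "\<delta> < 2 * B"
  shows "S_star d \<delta> B = 1 / 2 * sqrt (B * ln (2 * B / \<delta>) / (2 * real d))"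
proof -
  define L where "L = ln (2 * B / \<delta>)"
  have L: "L > 0" and B0: "B > 0" using \<delta> B by (auto simp: L_def)
  have "sqrt (B * L / (2 * real d)) * sqrt (2 * real d * B / L) = sqrt (B\<^sup>2)"
    unfolding real_sqrt_mult[symmetric] using L B0 d by (simp add: power2_eq_square)
  hence "sqrt (B * L / (2 * real d)) * sqrt (2 * real d * B / L) = B" using B0 by simp
  moreover have "sqrt (2 * real d * B / L) \<noteq> 0" using d L B0 by simp
  ultimately have "B / sqrt (2 * real d * B / L) = sqrt (B * L / (2 * real d))"
    by (simp only: divide_eq_eq) simp
  thus ?thesis unfolding S_star_def n_star_def L_def[symmetric] by simp
qed

text \<open>The square of the claimed rate times \<open>n_star\<close> is
  \<open>2 * sqrt 2 * d\<close>, so \<open>L\<close> and \<open>B\<close> cancel. Bounding this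
  below by \<open>d\<close> costs only a constant, and the resulting 4 is uniform in
  \<open>d\<close>, \<open>\<delta>\<close> and \<open>B\<close>.\<close>

lemma G_C_n_star_le:
  assumes d: "d \<ge> 1" and \<delta>: "0 < \<delta>" and B: "\<delta> < 2 * B"
  shows "G_C d \<delta> B (n_star d \<delta> B) \<le> 4 * (real d * ln (2 * B / \<delta>) / B) powr (1 / 4)"
proof -
  define L where "L = ln (2 * B / \<delta>)"
  define X where "X = (real d * L / B) powr (1 / 4)"
  have L: "L > 0" and B0: "B > 0" using \<delta> B by (auto simp: L_def)
  have "X\<^sup>2 = (real d * L / B) powr (1 / 2)"
    by (simp add: X_def power2_eq_square flip: powr_add)
  hence "X\<^sup>2 = sqrt (real d * L / B)" using L B0 by (simp add: powr_half_sqrt)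
  hence "X\<^sup>2 * n_star d \<delta> B = 2 * sqrt (real d * L / B * (2 * real d * B / L))"
    by (simp add: n_star_def L_def real_sqrt_mult[symmetric] del: times_divide_eq_left times_divide_eq_right)
  also have "real d * L / B * (2 * real d * B / L) = 2 * (real d)\<^sup>2"
    using L B0 by (simp add: power2_eq_square)
  also have "sqrt (2 * (real d)\<^sup>2) = sqrt 2 * real d" by (simp add: real_sqrt_mult)
  finally have "X\<^sup>2 * n_star d \<delta> B = 2 * (sqrt 2 * real d)" .
  moreover have "1 * real d \<le> sqrt 2 * real d" by (intro mult_right_mono) auto
  ultimately have "real d \<le> X\<^sup>2 * n_star d \<delta> B" by linarith
  hence "sqrt (real d) \<le> sqrt (X\<^sup>2 * n_star d \<delta> B)" by (rule real_sqrt_le_mono)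
  hence "sqrt (real d) \<le> X * sqrt (n_star d \<delta> B)" by (simp add: real_sqrt_mult X_def)
  thus ?thesis using n_star_pos[OF d \<delta> B]
    by (simp add: G_C_n_star[OF d \<delta> B] X_def L_def field_simps)
qed

section \<open>Minimisation of the reparametrised exact objective\<close>

definition G_param :: "real \<Rightarrow> real \<Rightarrow> real \<Rightarrow> real" where
  "G_param A D t = A * exp (- t\<^sup>2 / 2) + D * t * exp (t\<^sup>2 / 2)"

definition G_slope :: "real \<Rightarrow> real \<Rightarrow> real \<Rightarrow> real" where
  "G_slope A D t = D * exp (t\<^sup>2) * (1 + t\<^sup>2) - A * t"

lemma has_real_derivative_G_param:
  "(G_param A D has_real_derivative exp (- t\<^sup>2 / 2) * G_slope A D t) (at t)"
proof -
  have e: "exp (t * t) = exp (t * t / 2) * exp (t * t / 2)" by (simp flip: exp_add)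
  show ?thesis
    unfolding G_param_def [abs_def] G_slope_def
    by (auto intro!: derivative_eq_intros simp: e exp_minus field_simps power2_eq_square)
qed

text \<open>If the value at \<open>t\<close> were nonnegative, the mean value theorem would give a
  derivative that is nonnegative somewhere left of \<open>t\<close> and nonpositive somewhere right
  of it, although \<open>k'\<close> increases strictly on the positive reals.\<close>

lemma G_slope_neg_between_zeros:
  assumes D: "D > 0" and "0 < a" "a < t" "t < b" and a: "G_slope A D a = 0" and b: "G_slope A D b = 0"
  shows "G_slope A D t < 0"
proof -
  define k' where "k' = (\<lambda>t. D * exp (t\<^sup>2) * (2 * t) * (2 + t\<^sup>2) - A)"
  have der: "(G_slope A D has_real_derivative k' t) (at t)" for t
    unfolding G_slope_def [abs_def] k'_def
    by (auto intro!: derivative_eq_intros simp: algebra_simps power2_eq_square)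
  have mono: "k' x < k' y" if "0 < x" "x < y" for x y
    unfolding k'_def using D that
    by (intro diff_strict_right_mono mult_strict_mono mult_strict_left_mono) (auto intro!: add_pos_nonneg power_strict_mono)
  obtain u where u: "a < u" "u < t" "G_slope A D t - G_slope A D a = (t - a) * k' u"
    using MVT2[of a t "G_slope A D" k'] der assms by blast
  obtain v where v: "t < v" "v < b" "G_slope A D b - G_slope A D t = (b - t) * k' v"
    using MVT2[of t b "G_slope A D" k'] der assms by blast
  show ?thesis
  proof (rule ccontr)
    assume "\<not> G_slope A D t < 0"
    hence "(t - a) * k' u \<ge> 0" "(b - t) * k' v \<le> 0" using u v a b by auto
    hence "k' u \<ge> 0" "k' v \<le> 0" using assms by (auto simp: zero_le_mult_iff mult_le_0_iff)
    thus False using mono[of u v] u v assms by auto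
  qed
qed

lemma G_slope_eq_0_of_min:
  assumes t: "t > 0" and min: "\<And>s. 0 \<le> s \<Longrightarrow> G_param A D t \<le> G_param A D s"
  shows "G_slope A D t = 0"
proof -
  have "exp (- t\<^sup>2 / 2) * G_slope A D t = 0"
    \<comment> \<open>The radius of the neighbourhood is \<open>t\<close> itself, which keeps it
      inside the half-line where minimality is known.\<close>
    using DERIV_local_min[OF has_real_derivative_G_param t] min by auto
  thus ?thesis by simp
qed

text \<open>The value at 0 is \<open>A\<close>, and beyond \<open>A / D\<close> the second term
  alone exceeds \<open>A\<close>; hence a minimum over the compact interval up to
  \<open>A / D\<close> is global.\<close>

lemma G_param_min_exists:
  assumes A: "A > 0" and D: "D > 0"
  shows "\<exists>t\<ge>0. \<forall>s\<ge>0. G_param A D t \<le> G_param A D s"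
proof -
  have "continuous_on {0..A / D} (G_param A D)"
    by (meson has_real_derivative_G_param DERIV_isCont continuous_at_imp_continuous_on)
  then obtain t where t: "t \<in> {0..A / D}" "\<And>s. s \<in> {0..A / D} \<Longrightarrow> G_param A D t \<le> G_param A D s"
    using continuous_attains_inf[of "{0..A / D}" "G_param A D"] A D by auto
  have "G_param A D t \<le> G_param A D s" if s: "s > A / D" for s
  proof -
    have s0: "s > 0" using s A D by (meson divide_pos_pos less_trans)
    have "G_param A D t \<le> G_param A D 0" using t(2)[of 0] A D by simp
    also have "\<dots> = A" by (simp add: G_param_def)
    also have "A \<le> D * s" using s D by (simp add: field_simps)
    also have "\<dots> \<le> D * s * exp (s\<^sup>2 / 2)" using s0 D by simp
    also have "\<dots> \<le> G_param A D s" using A by (simp add: G_param_def)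
    finally show ?thesis .
  qed
  thus ?thesis using t by (metis atLeastAtMost_iff not_le)
qed

text \<open>Both minimisers are zeros of \<open>G_slope\<close>, so the objective would drop
  strictly from the smaller to the larger, against minimality of the smaller.\<close>

lemma G_param_min_unique:
  assumes D: "D > 0" and "0 < a" "0 < b"
    and min: "\<And>s. 0 \<le> s \<Longrightarrow> G_param A D a \<le> G_param A D s" "\<And>s. 0 \<le> s \<Longrightarrow> G_param A D b \<le> G_param A D s"
  shows "a = b"
proof -
  have *: False if "0 < x" "x < y" and m: "\<And>s. 0 \<le> s \<Longrightarrow> G_param A D x \<le> G_param A D s"
    "\<And>s. 0 \<le> s \<Longrightarrow> G_param A D y \<le> G_param A D s" for x y
  proof -
    have "G_slope A D x = 0" "G_slope A D y = 0"
      using that by (auto intro!: G_slope_eq_0_of_min)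
    moreover obtain z where z: "x < z" "z < y"
        "G_param A D y - G_param A D x = (y - x) * (exp (- z\<^sup>2 / 2) * G_slope A D z)"
      using MVT2[OF \<open>x < y\<close>, of "G_param A D" "\<lambda>z. exp (- z\<^sup>2 / 2) * G_slope A D z"]
        has_real_derivative_G_param by blast
    ultimately have "G_slope A D z < 0" using G_slope_neg_between_zeros[OF D] \<open>0 < x\<close> by blast
    hence "(y - x) * (exp (- z\<^sup>2 / 2) * G_slope A D z) < 0"
      using \<open>x < y\<close> by (simp add: mult_less_0_iff)
    thus False using m(1)[of y] z(3) \<open>0 < x\<close> \<open>x < y\<close> by linarith
  qed
  show ?thesis
    using *[OF assms(2) _ min] *[OF assms(3) _ min(2) min(1)] by (cases a b rule: linorder_cases) auto
qed

section \<open>Transfer to the exact minimiser and its implicit equation\<close>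

lemma G_eq_G_param:
  assumes \<delta>: "0 < \<delta>" and B: "B > 0" and t: "0 \<le> t"
  shows "G d \<delta> B (\<delta> / 2 * exp (t\<^sup>2)) = G_param (2 * sqrt (2 * real d / \<delta>)) (sqrt (\<delta> / (4 * B))) t"
proof -
  have s: "sqrt (exp (t\<^sup>2)) = exp (t\<^sup>2 / 2)"
    by (intro real_sqrt_unique) (simp_all add: power2_eq_square flip: exp_add)
  have l: "ln (2 * (\<delta> / 2 * exp (t\<^sup>2)) / \<delta>) = t\<^sup>2" using \<delta> by simp
  have "sqrt (\<delta> / 2 * exp (t\<^sup>2)) = sqrt (\<delta> / 2) * exp (t\<^sup>2 / 2)"
    by (simp only: real_sqrt_mult s)
  hence "2 * sqrt (real d) / sqrt (\<delta> / 2 * exp (t\<^sup>2)) = 2 * sqrt (2 * real d / \<delta>) * exp (- t\<^sup>2 / 2)"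
    by (simp add: exp_minus field_simps real_sqrt_divide real_sqrt_mult)
  moreover have "\<delta> / 2 * exp (t\<^sup>2) * t\<^sup>2 / (2 * B) = \<delta> / (4 * B) * t\<^sup>2 * exp (t\<^sup>2)" by simp
  hence "sqrt (\<delta> / 2 * exp (t\<^sup>2) * t\<^sup>2 / (2 * B)) = sqrt (\<delta> / (4 * B)) * t * exp (t\<^sup>2 / 2)"
    using t by (simp only: real_sqrt_mult s real_sqrt_abs abs_of_nonneg)
  ultimately show ?thesis by (simp only: G_def G_param_def l)
qed

text \<open>The substitution maps \<open>t \<ge> 0\<close> onto the admissible half-line, so
  constrained minimisation in \<open>n\<close> becomes minimisation over
  \<open>t \<ge> 0\<close>.\<close>

lemma exact_minimiser_iff:
  assumes \<delta>: "0 < \<delta>" and B: "B > 0"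
  shows "exact_minimiser d \<delta> B n \<longleftrightarrow> (\<exists>t\<ge>0. n = \<delta> / 2 * exp (t\<^sup>2) \<and>
    (\<forall>s\<ge>0. G_param (2 * sqrt (2 * real d / \<delta>)) (sqrt (\<delta> / (4 * B))) t \<le>
            G_param (2 * sqrt (2 * real d / \<delta>)) (sqrt (\<delta> / (4 * B))) s))"
proof -
  define \<phi> where "\<phi> = (\<lambda>t. \<delta> / 2 * exp (t\<^sup>2))"
  have dom: "0 < m \<and> 0 \<le> ln (2 * m / \<delta>) \<longleftrightarrow> (\<exists>t\<ge>0. m = \<phi> t)" for m
  proof safe
    assume "0 < m" "0 \<le> ln (2 * m / \<delta>)"
    thus "\<exists>t\<ge>0. m = \<phi> t"
      using \<delta> by (intro exI[of _ "sqrt (ln (2 * m / \<delta>))"]) (auto simp: \<phi>_def)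
  qed (use \<delta> in \<open>auto simp: \<phi>_def\<close>)
  have G_\<phi>: "G d \<delta> B (\<phi> t) =
      G_param (2 * sqrt (2 * real d / \<delta>)) (sqrt (\<delta> / (4 * B))) t" if "t \<ge> 0" for t
    unfolding \<phi>_def by (rule G_eq_G_param[OF \<delta> B that])
  have "exact_minimiser d \<delta> B n \<longleftrightarrow> (\<exists>t\<ge>0. n = \<phi> t \<and> (\<forall>s\<ge>0. G d \<delta> B (\<phi> t) \<le> G d \<delta> B (\<phi> s)))"
    unfolding exact_minimiser_def is_arg_min_linorder dom by blast
  also have "\<dots> \<longleftrightarrow> (\<exists>t\<ge>0. n = \<phi> t \<and>
      (\<forall>s\<ge>0. G_param (2 * sqrt (2 * real d / \<delta>)) (sqrt (\<delta> / (4 * B))) t \<le>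
              G_param (2 * sqrt (2 * real d / \<delta>)) (sqrt (\<delta> / (4 * B))) s))"
    by (simp add: G_\<phi> cong: conj_cong)
  finally show ?thesis by (simp only: \<phi>_def)
qed

text \<open>Rules out the boundary point, where the derivative need not vanish, as a
  minimiser.\<close>

lemma G_param_half_less_0:
  assumes d: "d \<ge> 1" and \<delta>: "0 < \<delta>" "\<delta> < 1" and B: "B \<ge> 1"
  shows "G_param (2 * sqrt (2 * real d / \<delta>)) (sqrt (\<delta> / (4 * B))) (1 / 2)
       < G_param (2 * sqrt (2 * real d / \<delta>)) (sqrt (\<delta> / (4 * B))) 0"
proof -
  define A where "A = 2 * sqrt (2 * real d / \<delta>)"
  define D where "D = sqrt (\<delta> / (4 * B))"
  define s :: real where "s = exp (1 / 8)"
  have "sqrt ((14 / 10)\<^sup>2) \<le> sqrt (2 * real d / \<delta>)"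
    using d \<delta> by (intro real_sqrt_le_mono) (simp add: field_simps power2_eq_square)
  hence A: "A \<ge> 28 / 10" by (simp add: A_def)
  have "D \<le> sqrt ((1 / 2)\<^sup>2)"
    unfolding D_def using \<delta> B by (intro real_sqrt_le_mono) (simp add: field_simps power2_eq_square)
  hence D: "D \<le> 1 / 2" by simp
  have "s * s = exp (1 / 4)" by (simp add: s_def flip: exp_add)
  also have "\<dots> \<le> 1 + 1 / 4 + (1 / 4)\<^sup>2" by (rule exp_bound) auto
  finally have ss: "s * s \<le> 21 / 16" by (simp add: power2_eq_square)
  have s: "s \<ge> 1 + 1 / 8" unfolding s_def by (rule exp_ge_add_one_self)
  \<comment> \<open>The claim is \<open>A / s + D / 2 * s < A\<close>, that is
    \<open>D / 2 * s\<^sup>2 < A * (s - 1)\<close>; the numerical bounds leave 21/64 < 7/20.\<close>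
  have "D / 2 * (s * s) \<le> 1 / 4 * (21 / 16)"
    using D ss by (intro mult_mono) auto
  also have "\<dots> < 28 / 10 * (1 / 8)" by simp
  also have "\<dots> \<le> A * (s - 1)" using A s by (intro mult_mono) auto
  finally have "A / s + D / 2 * s < A" using s by (simp add: field_simps)
  thus ?thesis by (simp add: G_param_def A_def D_def s_def exp_minus field_simps power2_eq_square)
qed

text \<open>The last hypothesis forces \<open>t \<noteq> 0\<close>; the equation is then the
  vanishing of \<open>G_slope\<close>, rewritten in \<open>n\<close>.\<close>

lemma exact_minimiser_implicit_eq:
  assumes d: "d \<ge> 1" and \<delta>: "0 < \<delta>" "\<delta> < 1" and B: "B > 0"
    and min: "exact_minimiser d \<delta> B n" and n: "1 \<le> B \<or> n \<noteq> \<delta> / 2"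
  shows "n * (ln (2 * n / \<delta>) + 1) = 2 * sqrt (2 * real d * B * ln (2 * n / \<delta>))"
proof -
  define A where "A = 2 * sqrt (2 * real d / \<delta>)"
  define D where "D = sqrt (\<delta> / (4 * B))"
  obtain t where t: "t \<ge> 0" "n = \<delta> / 2 * exp (t\<^sup>2)" "\<And>s. s \<ge> 0 \<Longrightarrow> G_param A D t \<le> G_param A D s"
    using min unfolding exact_minimiser_iff[OF \<delta>(1) B] A_def D_def by blast
  have "t \<noteq> 0"
  proof
    assume "t = 0"
    with t(3)[of "1 / 2"] n t(2) G_param_half_less_0[OF d \<delta>, of B] show False by (auto simp: A_def D_def)
  qed
  hence "G_slope A D t = 0" using G_slope_eq_0_of_min t by auto
  hence k: "D * (exp (t\<^sup>2) * (1 + t\<^sup>2)) = A * t" by (simp add: G_slope_def)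
  have l: "ln (2 * n / \<delta>) = t\<^sup>2" using \<delta> by (simp add: t(2))
  \<comment> \<open>Expresses \<open>A\<close> through \<open>D\<close>, so that \<open>D\<close>
    cancels from the stationarity equation.\<close>
  have c: "D * (2 * sqrt (2 * real d * B)) = \<delta> / 2 * A"
  proof -
    have "\<delta> / (4 * B) * (2 * real d * B) = (\<delta> / 2)\<^sup>2 * (2 * real d / \<delta>)"
      using \<delta> B by (simp add: power2_eq_square)
    hence "D * sqrt (2 * real d * B) = sqrt ((\<delta> / 2)\<^sup>2 * (2 * real d / \<delta>))"
      unfolding D_def by (simp only: flip: real_sqrt_mult)
    also have "\<dots> = \<delta> / 2 * sqrt (2 * real d / \<delta>)"
      using \<delta> by (simp only: real_sqrt_mult[of "(\<delta> / 2)\<^sup>2"] real_sqrt_abs)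
    finally show ?thesis by (simp add: A_def)
  qed
  have "D * (n * (t\<^sup>2 + 1)) = \<delta> / 2 * (D * (exp (t\<^sup>2) * (1 + t\<^sup>2)))"
    unfolding t(2) by (simp add: algebra_simps)
  also have "\<dots> = (\<delta> / 2 * A) * t" by (simp only: k mult.assoc)
  also have "\<dots> = D * (2 * sqrt (2 * real d * B) * t)" by (simp only: mult.assoc flip: c)
  finally have "D * (n * (t\<^sup>2 + 1)) = D * (2 * sqrt (2 * real d * B) * t)" .
  moreover have "D > 0" using \<delta> B by (simp add: D_def)
  ultimately have "n * (t\<^sup>2 + 1) = 2 * sqrt (2 * real d * B) * t" by simp
  thus ?thesis using t(1) by (simp add: l real_sqrt_mult)
qed

lemma exact_minimiser_ex1:
  assumes d: "d \<ge> 1" and \<delta>: "0 < \<delta>" "\<delta> < 1" and B: "B \<ge> 1"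
  shows "\<exists>!n. exact_minimiser d \<delta> B n"
proof -
  define A where "A = 2 * sqrt (2 * real d / \<delta>)"
  define D where "D = sqrt (\<delta> / (4 * B))"
  have A: "A > 0" and D: "D > 0" using d \<delta> B by (auto simp: A_def D_def)
  \<comment> \<open>Uniqueness is available for positive minimisers only.\<close>
  have pos: "t > 0" if "t \<ge> 0" "\<forall>s\<ge>0. G_param A D t \<le> G_param A D s" for t
    using that G_param_half_less_0[OF d \<delta> B] unfolding A_def D_def
    by (metis less_eq_real_def not_le zero_le_divide_1_iff zero_le_numeral)
  have iff: "exact_minimiser d \<delta> B n \<longleftrightarrow>
      (\<exists>t\<ge>0. n = \<delta> / 2 * exp (t\<^sup>2) \<and> (\<forall>s\<ge>0. G_param A D t \<le> G_param A D s))" for n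
    using exact_minimiser_iff[of \<delta> B] \<delta> B unfolding A_def D_def by simp
  show ?thesis
    unfolding iff using G_param_min_exists[OF A D] G_param_min_unique[OF D] pos by metis
qed

section \<open>Two-sided comparison of the exact and surrogate minimisers\<close>

lemma exact_minimiser_ge:
  assumes d: "d \<ge> 1" and \<delta>: "0 < \<delta>" and B: "\<delta> < 2 * B"
    and min: "exact_minimiser d \<delta> B n"
    and ns: "\<delta> / 2 \<le> n_star d \<delta> B" "n_star d \<delta> B \<le> B"
  shows "n_star d \<delta> B / 4 \<le> n"
proof -
  define m where "m = n_star d \<delta> B"
  have m: "m > 0" using n_star_pos[OF d \<delta> B] by (simp add: m_def)
  have n: "n > 0" "ln (2 * n / \<delta>) \<ge> 0"
    using min by (auto simp: exact_minimiser_def is_arg_min_linorder)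
  have "2 * sqrt (real d) / sqrt n \<le> G d \<delta> B n"
    using n \<delta> B by (simp add: G_def)
  \<comment> \<open>The first bound in \<open>ns\<close> makes \<open>m\<close> an admissible
    competitor; the second gives \<open>G \<le> G_C\<close> at \<open>m\<close> in the next
    step.\<close>
  also have "\<dots> \<le> G d \<delta> B m"
    using min ns m \<delta> by (auto simp: exact_minimiser_def is_arg_min_linorder m_def)
  also have "\<dots> \<le> G_C d \<delta> B m"
    unfolding G_def G_C_def using ns \<delta> m B
    by (auto intro!: divide_right_mono mult_left_mono simp: m_def)
  also have "\<dots> = 4 * sqrt (real d) / sqrt m" by (simp add: G_C_n_star[OF d \<delta> B] m_def)
  finally have "sqrt m \<le> 2 * sqrt n" using d m n by (simp add: field_simps)
  hence "sqrt m \<le> sqrt (4 * n)" by (simp add: real_sqrt_mult)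
  thus ?thesis by (simp add: m_def)
qed

text \<open>Weakening \<open>L + 1\<close> to \<open>L\<close> in the implicit equation gives
  \<open>n \<le> 2 * sqrt (2 * d * B / L)\<close>; replacing \<open>L\<close> by the lower bound
  \<open>M / 4\<close> costs a factor \<open>sqrt 4 = 2\<close>.\<close>

lemma exact_minimiser_le:
  assumes d: "d \<ge> 1" and \<delta>: "0 < \<delta>" "\<delta> < 1" and B: "1 \<le> B"
    and min: "exact_minimiser d \<delta> B n"
    and n: "ln (2 * B / \<delta>) \<le> 4 * ln (2 * n / \<delta>)"
  shows "n \<le> 2 * n_star d \<delta> B"
proof -
  define L where "L = ln (2 * n / \<delta>)"
  define M where "M = ln (2 * B / \<delta>)"
  have M: "M > 0" using \<delta> B by (simp add: M_def)
  have L: "L > 0" using n M by (simp add: L_def M_def)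
  have n0: "n > 0" using min by (auto simp: exact_minimiser_def is_arg_min_linorder)
  have "n * L \<le> n * (L + 1)" using n0 by simp
  also have "\<dots> = 2 * sqrt (2 * real d * B * L)"
    using exact_minimiser_implicit_eq[OF d \<delta> _ min] B by (simp add: L_def)
  also have "\<dots> = 2 * sqrt (2 * real d * B / L) * L"
    using L by (simp add: real_sqrt_mult real_sqrt_divide field_simps)
  finally have "n \<le> 2 * sqrt (2 * real d * B / L)" using L by simp
  also have "\<dots> \<le> 2 * sqrt (4 * (2 * real d * B / M))"
    using L M n B by (simp add: L_def M_def frac_le field_simps mult_left_mono)
  also have "\<dots> = 2 * n_star d \<delta> B" by (simp only: real_sqrt_mult) (simp add: n_star_def M_def real_sqrt_mult)
  finally show ?thesis .
qed

section \<open>Growth rates for large budgets\<close>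

lemma n_star_bigtheta:
  assumes "d \<ge> 1" "0 < \<delta>"
  shows "n_star d \<delta> \<in> \<Theta>(\<lambda>B. sqrt (B / ln B))"
proof -
  have "real d > 0" using assms by simp
  thus ?thesis using assms(2) unfolding n_star_def [abs_def] by real_asymp
qed

lemma S_star_bigtheta:
  assumes d: "d \<ge> 1" and \<delta>: "0 < \<delta>"
  shows "S_star d \<delta> \<in> \<Theta>(\<lambda>B. sqrt (B * ln B))"
proof -
  have "real d > 0" using assms by simp
  thus ?thesis using \<delta> unfolding S_star_def [abs_def] n_star_def [abs_def] by real_asymp
qed

lemma n_star_bigtheta_exact:
  assumes d: "d \<ge> 1" and \<delta>: "0 < \<delta>" "\<delta> < 1"
    and min: "\<forall>\<^sub>F B in at_top. exact_minimiser d \<delta> B (n_ex B)"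
  shows "n_star d \<delta> \<in> \<Theta>(n_ex)"
proof -
  have d0: "real d > 0" using d by simp
  have 1: "\<forall>\<^sub>F B in at_top. \<delta> / 2 \<le> n_star d \<delta> B"
    unfolding n_star_def using d0 \<delta>(1) by real_asymp
  have 2: "\<forall>\<^sub>F B in at_top. n_star d \<delta> B \<le> B"
    unfolding n_star_def using d0 \<delta>(1) by real_asymp
  \<comment> \<open>Since \<open>n_star\<close> grows like \<open>sqrt (B / ln B)\<close>, the
    logarithm on the right is asymptotically half of \<open>ln B\<close>, so the factor 4 leaves
    room.\<close>
  have 3: "\<forall>\<^sub>F B in at_top. ln (2 * B / \<delta>) \<le> 4 * ln (2 * (n_star d \<delta> B / 4) / \<delta>)"
    unfolding n_star_def using d0 \<delta>(1) by real_asymp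
  have "\<forall>\<^sub>F B in at_top. 0 < n_star d \<delta> B \<and> n_star d \<delta> B / 4 \<le> n_ex B \<and> n_ex B \<le> 2 * n_star d \<delta> B"
    using min 1 2 3 eventually_ge_at_top[of 1]
  proof eventually_elim
    case (elim B)
    hence B: "\<delta> < 2 * B" using \<delta> by simp
    note p = n_star_pos[OF d \<delta>(1) B]
    have ge: "n_star d \<delta> B / 4 \<le> n_ex B"
      using exact_minimiser_ge[OF d \<delta>(1) B] elim by blast
    hence "ln (2 * (n_star d \<delta> B / 4) / \<delta>) \<le> ln (2 * n_ex B / \<delta>)"
      using p \<delta> by (intro ln_mono divide_right_mono) auto
    hence "ln (2 * B / \<delta>) \<le> 4 * ln (2 * n_ex B / \<delta>)" using elim by linarith
    thus ?case using exact_minimiser_le[OF d \<delta>] elim ge p by blast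
  qed
  hence ev: "\<forall>\<^sub>F B in at_top. 0 < n_star d \<delta> B \<and> n_star d \<delta> B \<le> 4 * n_ex B \<and> n_ex B \<le> 2 * n_star d \<delta> B"
    by eventually_elim auto
  have "n_star d \<delta> \<in> O(n_ex)"
    by (rule bigoI[of _ 4]) (use ev in eventually_elim, auto)
  moreover have "n_ex \<in> O(n_star d \<delta>)"
    by (rule bigoI[of _ 2]) (use ev in eventually_elim, auto)
  ultimately show ?thesis by (simp add: bigtheta_def bigomega_iff_bigo)
qed

theorem theorem3p2:
  fixes d :: nat and \<delta> :: real
  assumes "d \<ge> 1" and "0 < \<delta>" and "\<delta> < 1"
  shows
    "(\<forall>B::real. \<delta> < 2 * B \<longrightarrow>
        (\<forall>n. is_arg_min (G_C d \<delta> B) (\<lambda>m. 0 < m) n \<longleftrightarrow> n = n_star d \<delta> B) \<and>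
        S_star d \<delta> B = 1 / 2 * sqrt (B * ln (2 * B / \<delta>) / (2 * real d)))
     \<and>
     n_star d \<delta> \<in> \<Theta>(\<lambda>B. sqrt (B / ln B)) \<and>
     S_star d \<delta> \<in> soft_bigtheta (\<lambda>B. sqrt (B / ln B)) \<and>
     S_star d \<delta> \<in> \<Theta>(\<lambda>B. sqrt (B * ln B))
     \<and>
     (\<lambda>B. G_C d \<delta> B (n_star d \<delta> B)) \<in> O(\<lambda>B. (real d * ln (2 * B / \<delta>) / B) powr (1 / 4)) \<and>
     (\<exists>C>0. \<forall>(d'::nat) (\<delta>'::real) B::real.
        1 \<le> d' \<and> 0 < \<delta>' \<and> \<delta>' < 1 \<and> \<delta>' < 2 * B \<longrightarrow>
        G_C d' \<delta>' B (n_star d' \<delta>' B) \<le> C * (real d' * ln (2 * B / \<delta>') / B) powr (1 / 4))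
     \<and>
     (\<forall>B\<ge>1. \<exists>!n. exact_minimiser d \<delta> B n) \<and>
     (\<forall>B>0. \<forall>n. exact_minimiser d \<delta> B n \<and> (1 \<le> B \<or> n \<noteq> \<delta> / 2) \<longrightarrow>
        n * (ln (2 * n / \<delta>) + 1) = 2 * sqrt (2 * real d * B * ln (2 * n / \<delta>))) \<and>
     (\<forall>n_ex. (\<forall>\<^sub>F B in at_top. exact_minimiser d \<delta> B (n_ex B)) \<longrightarrow>
        n_star d \<delta> \<in> \<Theta>(n_ex))"
proof (intro conjI)
  note d = assms(1) and \<delta> = assms(2,3)
  show "\<forall>B::real. \<delta> < 2 * B \<longrightarrow>
        (\<forall>n. is_arg_min (G_C d \<delta> B) (\<lambda>m. 0 < m) n \<longleftrightarrow> n = n_star d \<delta> B) \<and>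
        S_star d \<delta> B = 1 / 2 * sqrt (B * ln (2 * B / \<delta>) / (2 * real d))"
    using is_arg_min_G_C_iff[OF d \<delta>(1)] S_star_eq[OF d \<delta>(1)] by blast
  show "n_star d \<delta> \<in> \<Theta>(\<lambda>B. sqrt (B / ln B))" by (rule n_star_bigtheta[OF d \<delta>(1)])
  show S: "S_star d \<delta> \<in> \<Theta>(\<lambda>B. sqrt (B * ln B))" by (rule S_star_bigtheta[OF d \<delta>(1)])
  \<comment> \<open>For \<open>B > 1\<close> the two sides are equal, so a single logarithmic factor
    suffices; the exponent 1 serves both directions.\<close>
  have "(\<lambda>B::real. sqrt (B * ln B)) \<in> O(\<lambda>B. sqrt (B / ln B) * ln B ^ 1)" by real_asymp
  hence S1: "S_star d \<delta> \<in> O(\<lambda>B. sqrt (B / ln B) * ln B ^ 1)"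
    by (rule landau_o.big_trans[OF bigthetaD1[OF S]])
  have "(\<lambda>B::real. sqrt (B / ln B)) \<in> O(\<lambda>B. sqrt (B * ln B) * ln B ^ 1)" by real_asymp
  also have "(\<lambda>B. sqrt (B * ln B) * ln B ^ 1) \<in> O(\<lambda>B. S_star d \<delta> B * ln B ^ 1)"
    using S by (intro landau_o.big.mult_right) (simp add: bigtheta_sym bigthetaD1)
  finally show "S_star d \<delta> \<in> soft_bigtheta (\<lambda>B. sqrt (B / ln B))"
    using S1 unfolding soft_bigtheta_def by blast
  show "(\<lambda>B. G_C d \<delta> B (n_star d \<delta> B)) \<in> O(\<lambda>B. (real d * ln (2 * B / \<delta>) / B) powr (1 / 4))"
  proof (rule bigoI[of _ 4])
    show "\<forall>\<^sub>F B in at_top. norm (G_C d \<delta> B (n_star d \<delta> B))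
            \<le> 4 * norm ((real d * ln (2 * B / \<delta>) / B) powr (1 / 4))"
      using eventually_gt_at_top[of "\<delta> / 2"]
    proof eventually_elim
      case (elim B)
      hence B: "\<delta> < 2 * B" by simp
      have "G_C d \<delta> B (n_star d \<delta> B) \<ge> 0"
        using n_star_pos[OF d \<delta>(1) B] by (simp add: G_C_n_star[OF d \<delta>(1) B])
      thus ?case using G_C_n_star_le[OF d \<delta>(1) B] by simp
    qed
  qed
  show "\<exists>C>0. \<forall>(d'::nat) (\<delta>'::real) B::real.
        1 \<le> d' \<and> 0 < \<delta>' \<and> \<delta>' < 1 \<and> \<delta>' < 2 * B \<longrightarrow>
        G_C d' \<delta>' B (n_star d' \<delta>' B) \<le> C * (real d' * ln (2 * B / \<delta>') / B) powr (1 / 4)"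
    using G_C_n_star_le by (intro exI[of _ 4]) auto
  show "\<forall>B\<ge>1. \<exists>!n. exact_minimiser d \<delta> B n" using exact_minimiser_ex1[OF d \<delta>] by blast
  show "\<forall>B>0. \<forall>n. exact_minimiser d \<delta> B n \<and> (1 \<le> B \<or> n \<noteq> \<delta> / 2) \<longrightarrow>
        n * (ln (2 * n / \<delta>) + 1) = 2 * sqrt (2 * real d * B * ln (2 * n / \<delta>))"
    using exact_minimiser_implicit_eq[OF d \<delta>] by blast
  show "\<forall>n_ex. (\<forall>\<^sub>F B in at_top. exact_minimiser d \<delta> B (n_ex B)) \<longrightarrow> n_star d \<delta> \<in> \<Theta>(n_ex)"
    using n_star_bigtheta_exact[OF d \<delta>] by blast
qed

end
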